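(* Let $P$ be a finite discrete uniform distribution on $\mathbb{S}^2$ and $n\ge1$. Then there exists at least one configuration $Q^*\subset\mathbb{S}^2$ with $|Q^*|\le n$ such that $$V_{n,2}(P;Q^* )=\min_{Q\subset\mathbb{S}^2,\ |Q|\le n}V_{n,2}(P;Q).$$
   Context: $\mathbb{S}^2$ is the unit sphere in $\mathbb{R}^3$ with geodesic distance $d_G(x,y)=\arccos\langle x,y\rangle$. A finite discrete uniform distribution is $P=\frac1M\sum_{i=1}^M\delta_{x_i}$ for a finite set $X=\{x_1,\dots,x_M\}\subset\mathbb{S}^2$ of distinct points. Configurations $Q$ are finite nonempty subsets of $\mathbb{S}^2$, and $V_{n,2}(P;Q)=\frac1M\sum_{i=1}^M\min_{q\in Q}d_G(x_i,q)^2$. *)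

theory Defs
  imports "HOL-Analysis.Analysis" "HOL-Probability.Probability_Mass_Function"
begin

abbreviation unit_sphere :: "(real ^ 3) set" where
  "unit_sphere \<equiv> sphere 0 1"

definition geodesic_dist :: "real ^ 3 \<Rightarrow> real ^ 3 \<Rightarrow> real" where
  "geodesic_dist x y = arccos (x \<bullet> y)"

definition uniform_on_sphere :: "(real ^ 3) pmf \<Rightarrow> bool" where
  "uniform_on_sphere P \<longleftrightarrow>
     (\<exists>X. finite X \<and> X \<noteq> {} \<and> X \<subseteq> unit_sphere \<and> P = pmf_of_set X)"

definition configurations :: "nat \<Rightarrow> (real ^ 3) set set" where
  "configurations n = {Q. finite Q \<and> Q \<noteq> {} \<and> Q \<subseteq> unit_sphere \<and> card Q \<le> n}"

(* Only meaningful for uniform P, where the support of P is the set X of its M atoms,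
   and for finite nonempty Q. The index n of V_{n,2}(P;Q) does not enter its value. *)
definition quantization_error :: "(real ^ 3) pmf \<Rightarrow> (real ^ 3) set \<Rightarrow> real" where
  "quantization_error P Q =
     (1 / real (card (set_pmf P))) *
     (\<Sum>x\<in>set_pmf P. Min ((\<lambda>q. (geodesic_dist x q)\<^sup>2) ` Q))"

lemma quantization_error_pmf_of_set:
  assumes "finite X" and "X \<noteq> {}"
  shows "quantization_error (pmf_of_set X) Q =
    (1 / real (card X)) * (\<Sum>x\<in>X. Min ((\<lambda>q. (geodesic_dist x q)\<^sup>2) ` Q))"
  using assms by (simp add: quantization_error_def set_pmf_of_set)

lemma quantization_error_eq_expectation:
  assumes "uniform_on_sphere P"
  shows "quantization_error P Q =
    measure_pmf.expectation P (\<lambda>x. Min ((\<lambda>q. (geodesic_dist x q)\<^sup>2) ` Q))"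
proof -
  obtain X where "finite X" "X \<noteq> {}" "P = pmf_of_set X"
    using assms unfolding uniform_on_sphere_def by blast
  then show ?thesis
    by (simp add: quantization_error_pmf_of_set integral_pmf_of_set)
qed

end

theory Submission
  imports Defs
begin

text \<open>
  An \<open>n\<close>-tuple of points of the sphere is a point of a compact product space, and the images of
  \<open>n\<close>-tuples are exactly the configurations of at most \<open>n\<close> points. The error is continuous as a
  function of the tuple, so it attains its minimum.
\<close>

lemma continuous_on_Min_image:
  fixes g :: "'i \<Rightarrow> 'a::topological_space \<Rightarrow> 'b::linorder_topology"
  assumes "finite I" and "I \<noteq> {}" and "\<And>i. i \<in> I \<Longrightarrow> continuous_on S (g i)"
  shows "continuous_on S (\<lambda>f. Min ((\<lambda>i. g i f) ` I))"
  using assms by (induction I rule: finite_ne_induct) (auto intro: continuous_on_min)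

text \<open>Tychonoff's theorem. Since the index set is all of \<open>'a\<close>, extensionality is
  vacuous: \<open>PiE\<close> becomes the plain function space, and the product topology is the one
  the function type carries.\<close>

lemma compact_Pi_UNIV:
  fixes S :: "'b::topological_space set"
  assumes "compact S"
  shows "compact (UNIV \<rightarrow> S :: ('a \<Rightarrow> 'b) set)"
proof -
  have "compactin (product_topology (\<lambda>_. euclidean) UNIV) (PiE UNIV (\<lambda>_::'a. S))"
    using assms by (simp add: compactin_PiE)
  then show ?thesis
    by (simp add: euclidean_product_topology PiE_UNIV_domain)
qed

text \<open>\<open>arccos\<close> is continuous on [-1, 1], and Cauchy-Schwarz keeps inner products
  of unit vectors there.\<close>

lemma continuous_on_geodesic_dist:
  assumes "x \<in> unit_sphere"
  shows "continuous_on unit_sphere (geodesic_dist x)"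
proof -
  have "\<bar>x \<bullet> q\<bar> \<le> 1" if "q \<in> unit_sphere" for q
    using Cauchy_Schwarz_ineq2[of x q] assms that by simp
  then have "-1 \<le> x \<bullet> q \<and> x \<bullet> q \<le> 1" if "q \<in> unit_sphere" for q
    using that by (fastforce simp: abs_le_iff)
  then have "continuous_on unit_sphere (\<lambda>q. arccos (x \<bullet> q))"
    by (intro continuous_on_arccos continuous_intros) auto
  then show ?thesis
    by (simp add: geodesic_dist_def[abs_def])
qed

lemma continuous_on_quantization_error_image:
  fixes I :: "'i set"
  assumes "set_pmf P \<subseteq> unit_sphere" and "finite I" and "I \<noteq> {}"
  shows "continuous_on (UNIV \<rightarrow> unit_sphere) (\<lambda>f. quantization_error P (f ` I))"
proof -
  have "continuous_on (UNIV \<rightarrow> unit_sphere) (\<lambda>f. geodesic_dist x (f i))"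
    if "x \<in> unit_sphere" for x and i :: 'i
    by (rule continuous_on_compose2[OF continuous_on_geodesic_dist[OF that]])
      (auto intro: continuous_on_product_coordinates continuous_on_subset)
  \<comment> \<open>\<open>image_image\<close> turns each minimum over the image of \<open>I\<close>
    under \<open>f\<close> into one over the fixed index set \<open>I\<close>, even where
    \<open>f\<close> is not injective. What remains is a finite sum of finite minima of continuous
    functions.\<close>
  then show ?thesis
    using assms unfolding quantization_error_def image_image
    by (intro continuous_intros continuous_on_Min_image) auto
qed

text \<open>Repeated values account for configurations with fewer than \<open>n\<close> points, and
  \<open>n \<ge> 1\<close> makes every image nonempty. Tuples are coded as total functions, of which
  only the values below \<open>n\<close> count.\<close>

lemma configurations_eq_images:
  assumes "n \<ge> 1"
  shows "configurations n = (\<lambda>f. f ` {..<n}) ` (UNIV \<rightarrow> unit_sphere)"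
proof (intro subset_antisym subsetI)
  fix Q assume "Q \<in> configurations n"
  then have Q: "finite Q" "Q \<noteq> {}" "Q \<subseteq> unit_sphere" "card Q \<le> n"
    by (auto simp: configurations_def)
  obtain g where g: "bij_betw g {..<card Q} Q"
    using bij_betw_from_nat_into_finite[OF Q(1)] by blast
  obtain q where "q \<in> Q"
    using Q by blast
  \<comment> \<open>Enumerate \<open>Q\<close> by \<open>g\<close>, then repeat a point of
    \<open>Q\<close> forever, so that no value leaves \<open>Q\<close>.\<close>
  define f where "f i = (if i < card Q then g i else q)" for i
  have "f i \<in> Q" for i
    using g \<open>q \<in> Q\<close> by (auto simp: f_def bij_betw_def)
  moreover have "Q \<subseteq> f ` {..<n}"
  proof -
    have "Q = f ` {..<card Q}"
      using g by (simp add: f_def bij_betw_def)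
    also have "\<dots> \<subseteq> f ` {..<n}"
      using Q by auto
    finally show ?thesis .
  qed
  ultimately have "Q = f ` {..<n}" and "f \<in> UNIV \<rightarrow> unit_sphere"
    using Q by blast+
  then show "Q \<in> (\<lambda>f. f ` {..<n}) ` (UNIV \<rightarrow> unit_sphere)"
    by blast
next
  fix Q assume "Q \<in> (\<lambda>f. f ` {..<n}) ` (UNIV \<rightarrow> unit_sphere)"
  then obtain f where f: "Q = f ` {..<n}" "f \<in> UNIV \<rightarrow> unit_sphere"
    by blast
  moreover have "card (f ` {..<n}) \<le> n"
    using card_image_le[of "{..<n}" f] by simp
  moreover have "f ` {..<n} \<noteq> {}"
    using assms by (simp add: lessThan_empty_iff)
  ultimately show "Q \<in> configurations n"
    by (simp add: configurations_def image_subset_iff Pi_iff)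
qed

theorem proposition3p1:
  fixes P :: "(real ^ 3) pmf" and n :: nat
  assumes "uniform_on_sphere P"
    and "n \<ge> 1"
  shows "\<exists>Qs. is_arg_min (quantization_error P) (\<lambda>Q. Q \<in> configurations n) Qs"
proof -
  obtain X where "finite X" "X \<noteq> {}" "X \<subseteq> unit_sphere" "P = pmf_of_set X"
    using assms(1) unfolding uniform_on_sphere_def by blast
  then have P: "set_pmf P \<subseteq> unit_sphere"
    by simp
  let ?T = "UNIV \<rightarrow> unit_sphere :: (nat \<Rightarrow> real ^ 3) set"
  have "continuous_on ?T (\<lambda>f. quantization_error P (f ` {..<n}))"
    using P assms(2) by (intro continuous_on_quantization_error_image) (auto simp: lessThan_empty_iff)
  \<comment> \<open>A constant sequence at a unit coordinate vector shows that the compact domain is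
    nonempty, as attaining the infimum requires.\<close>
  moreover have "(\<lambda>_. axis 1 1) \<in> ?T"
    by simp
  then have "?T \<noteq> {}"
    by (metis empty_iff)
  ultimately obtain f where "f \<in> ?T"
    and "\<forall>g\<in>?T. quantization_error P (f ` {..<n}) \<le> quantization_error P (g ` {..<n})"
    using continuous_attains_inf[OF compact_Pi_UNIV[OF compact_sphere]] by blast
  then have "is_arg_min (quantization_error P) (\<lambda>Q. Q \<in> configurations n) (f ` {..<n})"
    by (auto simp: is_arg_min_linorder configurations_eq_images[OF assms(2)])
  then show ?thesis ..
qed

end
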